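(* Let $\Gamma_1,\Gamma_2$ be nonzero real numbers and consider the equations of motion of two point vortices with strengths $\Gamma_1,\Gamma_2$ at distinct points $(x_1,y_1),(x_2,y_2)$ of the chart $[0,\pi)\times\mathbb R$ of the Möbius band: $$\dot x_1=-\tfrac1{8\pi}\Big(\Gamma_2\tfrac{\sinh(y_1-y_2)}{\sin^2\frac{x_1-x_2}2+\sinh^2\frac{y_1-y_2}2}-\Gamma_2\tfrac{\sinh(y_1+y_2)}{\cos^2\frac{x_1-x_2}2+\sinh^2\frac{y_1+y_2}2}-2\Gamma_1\tanh y_1\Big),$$ $$\dot x_2=-\tfrac1{8\pi}\Big(\Gamma_1\tfrac{\sinh(y_2-y_1)}{\sin^2\frac{x_1-x_2}2+\sinh^2\frac{y_1-y_2}2}-\Gamma_1\tfrac{\sinh(y_1+y_2)}{\cos^2\frac{x_1-x_2}2+\sinh^2\frac{y_1+y_2}2}-2\Gamma_2\tanh y_2\Big),$$ $$\dot y_1=\tfrac{\Gamma_2\sin(x_1-x_2)}{8\pi}\Big(\tfrac1{\sin^2\frac{x_1-x_2}2+\sinh^2\frac{y_1-y_2}2}+\tfrac1{\cos^2\frac{x_1-x_2}2+\sinh^2\frac{y_1+y_2}2}\Big),$$ $$\dot y_2=\tfrac{\Gamma_1\sin(x_2-x_1)}{8\pi}\Big(\tfrac1{\sin^2\frac{x_1-x_2}2+\sinh^2\frac{y_1-y_2}2}+\tfrac1{\cos^2\frac{x_1-x_2}2+\sinh^2\frac{y_1+y_2}2}\Big).$$ If $\Gamma_1\Gamma_2>0$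 and $\Gamma_1\ne\Gamma_2$, the system is in a fixed equilibrium when $x_1=x_2$ and $(y_1,y_2)=(y_1^*,y_2^* )$, where $$y_1^*=\pm\operatorname{arcsinh}\sqrt{\frac{2\Gamma_2^2\big(\Gamma_1^4+\Gamma_2^4+\sqrt{\Gamma_1^8+\Gamma_1^6\Gamma_2^2+\Gamma_1^2\Gamma_2^6+\Gamma_2^8}\big)}{\Gamma_1^2(\Gamma_1^2-\Gamma_2^2)^2}},$$ $$y_2^*=\mp\operatorname{arcsinh}\sqrt{\frac{2\Gamma_1^2\big(\Gamma_1^4+\Gamma_2^4+\sqrt{\Gamma_1^8+\Gamma_1^6\Gamma_2^2+\Gamma_1^2\Gamma_2^6+\Gamma_2^8}\big)}{\Gamma_2^2(\Gamma_1^2-\Gamma_2^2)^2}}$$ (upper signs together or lower signs together). If $\Gamma_1\Gamma_2<0$ or $\Gamma_1=\Gamma_2$, there is no fixed equilibrium.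
   Context: The Möbius band is modelled as the strip of width $\pi$ and infinite height, with coordinates $(x,y)$, whose vertical sides are identified with opposite orientation. The signs of $\Gamma_1,\Gamma_2$ are those in the chart $0\le x<\pi$. A fixed equilibrium is a configuration (of two distinct points) at which $\dot x_1=\dot x_2=\dot y_1=\dot y_2=0$. *)

theory Defs
  imports Complex_Main
begin

text \<open>The Moebius band of width \<open>pi\<close>, in the half-open chart: every point of the band
  has exactly one representative here, so distinct points of the band are distinct pairs.\<close>

definition mobius_chart :: "(real \<times> real) set" where
  "mobius_chart = {0..<pi} \<times> UNIV"

text \<open>The two denominators below are the contributions of the other vortex and of its
  image under the glide reflection \<open>(x, y) \<mapsto> (x + pi, - y)\<close>. On distinct points of the chart
  both are positive, so no division by zero occurs there.\<close>

definition x1_dot :: "real \<Rightarrow> real \<Rightarrow> real \<times> real \<Rightarrow> real \<times> real \<Rightarrow> real" where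
  "x1_dot \<Gamma>1 \<Gamma>2 = (\<lambda>(x1, y1) (x2, y2).
     - (1 / (8 * pi)) *
       (\<Gamma>2 * (sinh (y1 - y2) / ((sin ((x1 - x2) / 2))\<^sup>2 + (sinh ((y1 - y2) / 2))\<^sup>2))
        - \<Gamma>2 * (sinh (y1 + y2) / ((cos ((x1 - x2) / 2))\<^sup>2 + (sinh ((y1 + y2) / 2))\<^sup>2))
        - 2 * \<Gamma>1 * tanh y1))"

definition x2_dot :: "real \<Rightarrow> real \<Rightarrow> real \<times> real \<Rightarrow> real \<times> real \<Rightarrow> real" where
  "x2_dot \<Gamma>1 \<Gamma>2 = (\<lambda>(x1, y1) (x2, y2).
     - (1 / (8 * pi)) *
       (\<Gamma>1 * (sinh (y2 - y1) / ((sin ((x1 - x2) / 2))\<^sup>2 + (sinh ((y1 - y2) / 2))\<^sup>2))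
        - \<Gamma>1 * (sinh (y1 + y2) / ((cos ((x1 - x2) / 2))\<^sup>2 + (sinh ((y1 + y2) / 2))\<^sup>2))
        - 2 * \<Gamma>2 * tanh y2))"

definition y1_dot :: "real \<Rightarrow> real \<Rightarrow> real \<times> real \<Rightarrow> real \<times> real \<Rightarrow> real" where
  "y1_dot \<Gamma>1 \<Gamma>2 = (\<lambda>(x1, y1) (x2, y2).
     \<Gamma>2 * sin (x1 - x2) / (8 * pi) *
       (1 / ((sin ((x1 - x2) / 2))\<^sup>2 + (sinh ((y1 - y2) / 2))\<^sup>2)
        + 1 / ((cos ((x1 - x2) / 2))\<^sup>2 + (sinh ((y1 + y2) / 2))\<^sup>2)))"

definition y2_dot :: "real \<Rightarrow> real \<Rightarrow> real \<times> real \<Rightarrow> real \<times> real \<Rightarrow> real" where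
  "y2_dot \<Gamma>1 \<Gamma>2 = (\<lambda>(x1, y1) (x2, y2).
     \<Gamma>1 * sin (x2 - x1) / (8 * pi) *
       (1 / ((sin ((x1 - x2) / 2))\<^sup>2 + (sinh ((y1 - y2) / 2))\<^sup>2)
        + 1 / ((cos ((x1 - x2) / 2))\<^sup>2 + (sinh ((y1 + y2) / 2))\<^sup>2)))"

definition fixed_equilibrium ::
    "real \<Rightarrow> real \<Rightarrow> real \<times> real \<Rightarrow> real \<times> real \<Rightarrow> bool" where
  "fixed_equilibrium \<Gamma>1 \<Gamma>2 p q \<longleftrightarrow>
     p \<in> mobius_chart \<and> q \<in> mobius_chart \<and> p \<noteq> q \<and>
     x1_dot \<Gamma>1 \<Gamma>2 p q = 0 \<and> x2_dot \<Gamma>1 \<Gamma>2 p q = 0 \<and>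
     y1_dot \<Gamma>1 \<Gamma>2 p q = 0 \<and> y2_dot \<Gamma>1 \<Gamma>2 p q = 0"

end

theory Submission
  imports Defs
begin

text \<open>The two denominators are positive on distinct points of the chart, so \<open>y1_dot = 0\<close> forces
  \<open>x1 = x2\<close>. The half-angle formulas then turn \<open>x1_dot = x2_dot = 0\<close> into
  \<open>2 \<Gamma>2 cosh y1 cosh y2 = \<Gamma>1 sinh y1 (sinh y1 - sinh y2)\<close> and
  \<open>2 \<Gamma>1 cosh y1 cosh y2 = \<Gamma>2 sinh y2 (sinh y2 - sinh y1)\<close>,
  hence \<open>\<Gamma>1\<^sup>2 sinh y1 = - \<Gamma>2\<^sup>2 sinh y2\<close>. So \<open>sinh y1\<close> and \<open>sinh y2\<close> have opposite signs, which
  forces \<open>\<Gamma>1 \<Gamma>2 > 0\<close>; for \<open>\<Gamma>1 = \<Gamma>2\<close> the equations would say \<open>cosh\<^sup>2 y1 = sinh\<^sup>2 y1\<close>. Otherwise,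
  with \<open>sinh y1 = \<Gamma>2\<^sup>2 t\<close> and \<open>sinh y2 = - \<Gamma>1\<^sup>2 t\<close>, they become a quadratic equation for \<open>t\<^sup>2\<close>.\<close>

text \<open>Exchanging the vortices only flips signs inside even functions, so every fact about
  \<open>x1_dot\<close> also serves for \<open>x2_dot\<close>.\<close>

lemma x2_dot_swap: "x2_dot \<Gamma>1 \<Gamma>2 p q = x1_dot \<Gamma>2 \<Gamma>1 q p"
proof -
  obtain x1 y1 x2 y2 where pq: "p = (x1, y1)" "q = (x2, y2)" by fastforce
  have "(x2 - x1) / 2 = - ((x1 - x2) / 2)" "(y2 - y1) / 2 = - ((y1 - y2) / 2)"
    by (simp_all add: minus_divide_left)
  then show ?thesis
    unfolding pq x1_dot_def x2_dot_def
    by (simp only: prod.case sin_minus cos_minus sinh_minus power2_minus add.commute[of y2 y1])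
qed

text \<open>The left side is \<open>2 coth u - 2 tanh v\<close>; over the common denominator
  \<open>sinh u * cosh v\<close> the numerator is the subtraction formula for
  \<open>cosh (u - v)\<close>.\<close>

lemma sinh_half_angle_difference:
  fixes u v :: real
  assumes "u \<noteq> 0"
  shows "sinh (2 * u) / (sinh u)\<^sup>2 - sinh (2 * v) / (cosh v)\<^sup>2
    = 4 * cosh (u - v) / (sinh (u + v) + sinh (u - v))"
proof -
  have "sinh u \<noteq> 0" using assms by simp
  moreover have "cosh v \<noteq> 0" by simp
  moreover have "sinh (u + v) + sinh (u - v) = 2 * (sinh u * cosh v)"
    by (simp add: sinh_add sinh_diff)
  ultimately show ?thesis
    unfolding cosh_diff sinh_double by (simp add: divide_simps power2_eq_square algebra_simps)
qed

lemma x1_dot_vertical: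
  assumes "y1 \<noteq> y2"
  shows "x1_dot \<Gamma>1 \<Gamma>2 (x, y1) (x, y2)
    = - (2 * \<Gamma>2 * cosh y2 / (sinh y1 - sinh y2) - \<Gamma>1 * (sinh y1 / cosh y1)) / (4 * pi)"
proof -
  define u v where "u = (y1 - y2) / 2" and "v = (y1 + y2) / 2"
  have uv: "y1 = u + v" "y2 = v - u" "y1 - y2 = 2 * u" "y1 + y2 = 2 * v"
    unfolding u_def v_def by (simp_all add: field_simps)
  have "u \<noteq> 0" using assms by (simp add: u_def)
  have half: "(x - x) / 2 = 0" "(y1 - y2) / 2 = u" "(y1 + y2) / 2 = v"
    by (simp_all add: u_def v_def)
  have "sinh (2 * u) / (sinh u)\<^sup>2 - sinh (2 * v) / (1 + (sinh v)\<^sup>2)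
      = 4 * cosh (u - v) / (sinh (u + v) + sinh (u - v))"
    using sinh_half_angle_difference[OF \<open>u \<noteq> 0\<close>, of v] by (simp add: cosh_square_eq add.commute)
  also have "cosh (u - v) = cosh y2"
    using cosh_minus[of "u - v"] by (simp add: uv(2))
  also have "sinh (u + v) + sinh (u - v) = sinh y1 - sinh y2"
    using sinh_minus[of "u - v"] by (simp add: uv(1,2))
  finally have eq: "sinh (2 * u) / (sinh u)\<^sup>2 - sinh (2 * v) / (1 + (sinh v)\<^sup>2)
      = 4 * cosh y2 / (sinh y1 - sinh y2)" .
  have "x1_dot \<Gamma>1 \<Gamma>2 (x, y1) (x, y2) = - (1 / (8 * pi)) *
      (\<Gamma>2 * (sinh (2 * u) / (sinh u)\<^sup>2 - sinh (2 * v) / (1 + (sinh v)\<^sup>2)) - 2 * \<Gamma>1 * tanh y1)"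
    unfolding x1_dot_def prod.case half uv(3,4) by (simp add: right_diff_distrib)
  also have "\<dots> = - (1 / (8 * pi)) *
      (\<Gamma>2 * (4 * (cosh y2 / (sinh y1 - sinh y2))) - 2 * \<Gamma>1 * (sinh y1 / cosh y1))"
    unfolding eq tanh_def by simp
  also have "- (1 / (8 * pi)) * (\<Gamma>2 * (4 * A) - 2 * \<Gamma>1 * B) = - (2 * \<Gamma>2 * A - \<Gamma>1 * B) / (4 * pi)" for A B
    by (simp add: field_simps)
  finally show ?thesis by simp
qed

lemma x1_dot_vertical_eq_0_iff:
  assumes "y1 \<noteq> y2"
  shows "x1_dot \<Gamma>1 \<Gamma>2 (x, y1) (x, y2) = 0 \<longleftrightarrow>
    2 * \<Gamma>2 * (cosh y1 * cosh y2) = \<Gamma>1 * sinh y1 * (sinh y1 - sinh y2)"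
proof -
  have "sinh y1 - sinh y2 \<noteq> 0" using assms by simp
  moreover have "cosh y1 \<noteq> 0" by simp
  ultimately have "2 * \<Gamma>2 * cosh y2 / (sinh y1 - sinh y2) = \<Gamma>1 * (sinh y1 / cosh y1) \<longleftrightarrow>
    2 * \<Gamma>2 * (cosh y1 * cosh y2) = \<Gamma>1 * sinh y1 * (sinh y1 - sinh y2)"
    by (simp add: frac_eq_eq mult_ac)
  then show ?thesis
    by (auto simp: x1_dot_vertical[OF assms])
qed

lemma y1_dot_eq_0_imp_vertical:
  assumes "\<Gamma>2 \<noteq> 0" "x1 \<in> {0..<pi}" "x2 \<in> {0..<pi}"
    and "y1_dot \<Gamma>1 \<Gamma>2 (x1, y1) (x2, y2) = 0"
  shows "x1 = x2"
proof (rule ccontr)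
  assume "x1 \<noteq> x2"
  define d where "d = (x1 - x2) / 2"
  \<comment> \<open>Both abscissae lie in an interval of length \<open>pi\<close>, so
    \<open>d\<close> stays where \<open>cos\<close> is positive and \<open>sin\<close> vanishes only
    at 0.\<close>
  have d: "d \<noteq> 0" "- pi / 2 < d" "d < pi / 2"
    using assms(2,3) \<open>x1 \<noteq> x2\<close> by (auto simp: d_def)
  have "cos d > 0" using d by (intro cos_gt_zero_pi) auto
  have "sin d \<noteq> 0" using d sin_gt_zero[of d] sin_gt_zero[of "- d"] by (cases "d > 0") auto
  have "x1 - x2 = 2 * d" by (simp add: d_def)
  then have "sin (x1 - x2) = 2 * sin d * cos d"
    by (simp only: sin_double)
  then have "sin (x1 - x2) \<noteq> 0"
    using \<open>sin d \<noteq> 0\<close> \<open>cos d > 0\<close> by simp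
  moreover have "1 / ((sin d)\<^sup>2 + (sinh ((y1 - y2) / 2))\<^sup>2)
      + 1 / ((cos d)\<^sup>2 + (sinh ((y1 + y2) / 2))\<^sup>2) > 0"
    using \<open>sin d \<noteq> 0\<close> \<open>cos d > 0\<close> by (intro add_pos_pos divide_pos_pos add_pos_nonneg) simp_all
  ultimately show False
    using assms(1,4) unfolding y1_dot_def prod.case d_def[symmetric] by simp
qed

lemma fixed_equilibrium_iff:
  assumes "\<Gamma>2 \<noteq> 0"
  shows "fixed_equilibrium \<Gamma>1 \<Gamma>2 (x1, y1) (x2, y2) \<longleftrightarrow>
    x1 \<in> {0..<pi} \<and> x2 = x1 \<and> y1 \<noteq> y2 \<and>
    2 * \<Gamma>2 * (cosh y1 * cosh y2) = \<Gamma>1 * sinh y1 * (sinh y1 - sinh y2) \<and>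
    2 * \<Gamma>1 * (cosh y1 * cosh y2) = \<Gamma>2 * sinh y2 * (sinh y2 - sinh y1)"
proof (cases "x1 \<in> {0..<pi} \<and> x2 = x1 \<and> y1 \<noteq> y2")
  case True
  then show ?thesis
    using x1_dot_vertical_eq_0_iff[of y1 y2 \<Gamma>1 \<Gamma>2 x1] x1_dot_vertical_eq_0_iff[of y2 y1 \<Gamma>2 \<Gamma>1 x1]
    by (simp add: fixed_equilibrium_def mobius_chart_def x2_dot_swap y1_dot_def y2_dot_def
        mult.commute[of "cosh y2"])
next
  \<comment> \<open>Equal abscissae together with \<open>y1 = y2\<close> would make the two points
    coincide.\<close>
  case False
  then show ?thesis
    using y1_dot_eq_0_imp_vertical[OF assms, of x1 x2 \<Gamma>1 y1 y2]
    by (auto simp: fixed_equilibrium_def mobius_chart_def)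
qed

text \<open>Expanding the second claim gives
  \<open>K * T\<^sup>2 - 4 * (a^4 + b^4) * T - 4 = 0\<close> with \<open>K\<close> as below. The
  roots have negative product, and \<open>T\<close> is the positive one.\<close>

lemma vortex_quadratic_root:
  fixes a b :: real
  assumes "a \<noteq> 0" "b \<noteq> 0" "a\<^sup>2 \<noteq> b\<^sup>2"
  defines "T \<equiv> 2 * (a^4 + b^4 + sqrt (a^8 + a^6 * b^2 + a^2 * b^6 + b^8))
    / (a\<^sup>2 * b\<^sup>2 * (a\<^sup>2 - b\<^sup>2)\<^sup>2)"
  shows "T > 0" and "4 * (1 + b^4 * T) * (1 + a^4 * T) = (a * b * (a\<^sup>2 + b\<^sup>2) * T)\<^sup>2"
proof -
  define R where "R = a^8 + a^6 * b^2 + a^2 * b^6 + b^8"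
  define K where "K = a\<^sup>2 * b\<^sup>2 * (a\<^sup>2 - b\<^sup>2)\<^sup>2"
  have "R \<ge> 0" unfolding R_def by simp
  then have sq: "(sqrt R)\<^sup>2 = R" by simp
  \<comment> \<open>The radicand is a quarter of the discriminant of the quadratic divided by 4,
    which explains the mixed terms of degree 8.\<close>
  have R: "R = (a^4 + b^4)\<^sup>2 + K" unfolding R_def K_def by algebra
  have "K > 0" using assms(1-3) by (simp add: K_def)
  have KT: "K * T = 2 * (a^4 + b^4 + sqrt R)"
    using \<open>K > 0\<close> unfolding T_def R_def[symmetric] K_def[symmetric] by simp
  have "a^4 + b^4 + sqrt R > 0"
    using assms(1) \<open>R \<ge> 0\<close> by (intro add_pos_nonneg) simp_all
  then show "T > 0"
    using \<open>K > 0\<close> unfolding T_def R_def[symmetric] K_def[symmetric] by simp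
  have "(K * T - 2 * (a^4 + b^4))\<^sup>2 = 4 * ((a^4 + b^4)\<^sup>2 + K)"
    unfolding KT R[symmetric] by (simp add: sq power_mult_distrib)
  then have "K * (K * T\<^sup>2 - 4 * (a^4 + b^4) * T - 4) = 0" by algebra
  then have "K * T\<^sup>2 - 4 * (a^4 + b^4) * T - 4 = 0" using \<open>K > 0\<close> by simp
  then show "4 * (1 + b^4 * T) * (1 + a^4 * T) = (a * b * (a\<^sup>2 + b\<^sup>2) * T)\<^sup>2"
    unfolding K_def by algebra
qed

text \<open>With these values of \<open>sinh\<close>, both equilibrium equations reduce to \<open>2
  * (cosh y1 * cosh y2) = a * b * (a\<^sup>2 + b\<^sup>2) * t\<^sup>2\<close>, whose square is
  \<open>quad\<close>.\<close>

lemma vortex_pair_equilibrium: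
  fixes a b t :: real
  assumes ab: "a * b > 0" and t: "t \<noteq> 0"
    and y: "sinh y1 = b\<^sup>2 * t" "sinh y2 = - (a\<^sup>2 * t)"
    and quad: "4 * (1 + b^4 * t\<^sup>2) * (1 + a^4 * t\<^sup>2) = (a * b * (a\<^sup>2 + b\<^sup>2) * t\<^sup>2)\<^sup>2"
    and x: "x \<in> {0..<pi}"
  shows "fixed_equilibrium a b (x, y1) (x, y2)"
proof -
  have nz: "a \<noteq> 0" "b \<noteq> 0" using ab by auto
  have "a\<^sup>2 + b\<^sup>2 > 0" using nz by (simp add: add_pos_pos)
  then have "(a\<^sup>2 + b\<^sup>2) * t \<noteq> 0" using t by (simp add: nz)
  then have "sinh y1 \<noteq> sinh y2" by (simp add: y algebra_simps)
  then have "y1 \<noteq> y2" by auto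
  have "(2 * (cosh y1 * cosh y2))\<^sup>2 = 4 * (1 + b^4 * t\<^sup>2) * (1 + a^4 * t\<^sup>2)"
    by (simp add: power_mult_distrib cosh_square_eq y algebra_simps flip: power_mult)
  also note quad
  \<comment> \<open>The square root may be taken because \<open>a * b > 0\<close> makes both sides
    nonnegative.\<close>
  finally have "2 * (cosh y1 * cosh y2) = a * b * (a\<^sup>2 + b\<^sup>2) * t\<^sup>2"
    using ab by (subst (asm) power2_eq_iff_nonneg) (auto intro!: mult_nonneg_nonneg less_imp_le)
  then have "2 * b * (cosh y1 * cosh y2) = a * sinh y1 * (sinh y1 - sinh y2)"
    "2 * a * (cosh y1 * cosh y2) = b * sinh y2 * (sinh y2 - sinh y1)"
    unfolding y by algebra+
  then show ?thesis
    using x \<open>y1 \<noteq> y2\<close> by (simp add: fixed_equilibrium_iff nz)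
qed

lemma fixed_equilibrium_imp:
  assumes "a \<noteq> 0" "b \<noteq> 0" "fixed_equilibrium a b (x1, y1) (x2, y2)"
  shows "a * b > 0" and "a \<noteq> b"
proof -
  define s1 s2 c where "s1 = sinh y1" and "s2 = sinh y2" and "c = cosh y1 * cosh y2"
  have ne: "s1 \<noteq> s2"
    and e1: "2 * b * c = a * s1 * (s1 - s2)" and e2: "2 * a * c = b * s2 * (s2 - s1)"
    using assms by (auto simp: fixed_equilibrium_iff s1_def s2_def c_def)
  have "c > 0" by (simp add: c_def)
  \<comment> \<open>Multiplying \<open>e1\<close> by \<open>a\<close> and \<open>e2\<close> by
    \<open>b\<close> makes the left sides equal; this is the difference of the right sides.\<close>
  have "(s1 - s2) * (a\<^sup>2 * s1 + b\<^sup>2 * s2) = 0" using e1 e2 by algebra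
  then have rel: "a\<^sup>2 * s1 + b\<^sup>2 * s2 = 0" using ne by simp
  \<comment> \<open>Scaling \<open>e1\<close> by \<open>a * b\<^sup>2\<close> lets
    \<open>rel\<close> replace \<open>b\<^sup>2 * s2\<close> by \<open>- a\<^sup>2 * s1\<close>,
    which leaves a visibly nonnegative right side.\<close>
  have "2 * b\<^sup>2 * c * (a * b) = a\<^sup>2 * s1 * (b\<^sup>2 * s1 - b\<^sup>2 * s2)" using e1 by algebra
  also have "\<dots> = (a * s1)\<^sup>2 * (a\<^sup>2 + b\<^sup>2)" using rel by algebra
  also have "\<dots> \<ge> 0" by simp
  finally have "2 * b\<^sup>2 * c * (a * b) \<ge> 0" .
  moreover have "2 * b\<^sup>2 * c > 0" using assms(2) \<open>c > 0\<close> by simp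
  ultimately have "a * b \<ge> 0" by (metis zero_le_mult_iff not_le)
  then show "a * b > 0" using assms(1,2) by (simp add: less_le)
  show "a \<noteq> b"
  proof
    assume "a = b"
    then have "s1 + s2 = 0" using rel assms(1) by (simp flip: distrib_left)
    then have "sinh y2 = - sinh y1" by (simp add: s1_def s2_def)
    then have "y2 = - y1" by (simp flip: sinh_minus)
    then have "2 * b * (cosh y1)\<^sup>2 = 2 * b * (sinh y1)\<^sup>2"
      using e1 \<open>a = b\<close> by (simp add: s1_def s2_def c_def power2_eq_square)
    then show False using assms(2) by (simp add: cosh_square_eq)
  qed
qed

theorem proposition4p7:
  fixes \<Gamma>1 \<Gamma>2 :: real
  assumes "\<Gamma>1 \<noteq> 0" and "\<Gamma>2 \<noteq> 0"
  shows "(\<Gamma>1 * \<Gamma>2 > 0 \<and> \<Gamma>1 \<noteq> \<Gamma>2 \<longrightarrow>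
           (\<forall>x1 x2 y1 y2. \<forall>\<sigma> \<in> {1, - 1 :: real}.
              x1 \<in> {0..<pi} \<and> x2 \<in> {0..<pi} \<and> x1 = x2 \<and>
              y1 = \<sigma> * arsinh (sqrt
                (2 * \<Gamma>2^2 * (\<Gamma>1^4 + \<Gamma>2^4 + sqrt (\<Gamma>1^8 + \<Gamma>1^6 * \<Gamma>2^2 + \<Gamma>1^2 * \<Gamma>2^6 + \<Gamma>2^8))
                 / (\<Gamma>1^2 * (\<Gamma>1^2 - \<Gamma>2^2)^2))) \<and>
              y2 = - \<sigma> * arsinh (sqrt
                (2 * \<Gamma>1^2 * (\<Gamma>1^4 + \<Gamma>2^4 + sqrt (\<Gamma>1^8 + \<Gamma>1^6 * \<Gamma>2^2 + \<Gamma>1^2 * \<Gamma>2^6 + \<Gamma>2^8))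
                 / (\<Gamma>2^2 * (\<Gamma>1^2 - \<Gamma>2^2)^2)))
              \<longrightarrow> fixed_equilibrium \<Gamma>1 \<Gamma>2 (x1, y1) (x2, y2)))
       \<and> (\<Gamma>1 * \<Gamma>2 < 0 \<or> \<Gamma>1 = \<Gamma>2 \<longrightarrow> \<not> (\<exists>p q. fixed_equilibrium \<Gamma>1 \<Gamma>2 p q))"
proof (intro conjI impI allI ballI)
  fix x1 x2 y1 y2 \<sigma> :: real
  define S where "S = \<Gamma>1^4 + \<Gamma>2^4 + sqrt (\<Gamma>1^8 + \<Gamma>1^6 * \<Gamma>2^2 + \<Gamma>1^2 * \<Gamma>2^6 + \<Gamma>2^8)"
  \<comment> \<open>\<open>T\<close> is the common value of
    \<open>(sinh y1)\<^sup>2 / \<Gamma>2^4\<close> and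
    \<open>(sinh y2)\<^sup>2 / \<Gamma>1^4\<close>.\<close>
  define T where "T = 2 * S / (\<Gamma>1\<^sup>2 * \<Gamma>2\<^sup>2 * (\<Gamma>1\<^sup>2 - \<Gamma>2\<^sup>2)\<^sup>2)"
  assume \<Gamma>: "\<Gamma>1 * \<Gamma>2 > 0 \<and> \<Gamma>1 \<noteq> \<Gamma>2" and \<sigma>: "\<sigma> \<in> {1, - 1}"
    and "x1 \<in> {0..<pi} \<and> x2 \<in> {0..<pi} \<and> x1 = x2 \<and>
      y1 = \<sigma> * arsinh (sqrt
        (2 * \<Gamma>2^2 * (\<Gamma>1^4 + \<Gamma>2^4 + sqrt (\<Gamma>1^8 + \<Gamma>1^6 * \<Gamma>2^2 + \<Gamma>1^2 * \<Gamma>2^6 + \<Gamma>2^8))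
         / (\<Gamma>1^2 * (\<Gamma>1^2 - \<Gamma>2^2)^2))) \<and>
      y2 = - \<sigma> * arsinh (sqrt
        (2 * \<Gamma>1^2 * (\<Gamma>1^4 + \<Gamma>2^4 + sqrt (\<Gamma>1^8 + \<Gamma>1^6 * \<Gamma>2^2 + \<Gamma>1^2 * \<Gamma>2^6 + \<Gamma>2^8))
         / (\<Gamma>2^2 * (\<Gamma>1^2 - \<Gamma>2^2)^2)))"
  then have x: "x1 \<in> {0..<pi}" "x2 = x1"
    and y: "y1 = \<sigma> * arsinh (sqrt (2 * \<Gamma>2^2 * S / (\<Gamma>1^2 * (\<Gamma>1^2 - \<Gamma>2^2)^2)))"
      "y2 = - \<sigma> * arsinh (sqrt (2 * \<Gamma>1^2 * S / (\<Gamma>2^2 * (\<Gamma>1^2 - \<Gamma>2^2)^2)))"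
    by (simp_all add: S_def)
  have "\<Gamma>1\<^sup>2 \<noteq> \<Gamma>2\<^sup>2"
    using \<Gamma> by (auto simp: power2_eq_iff zero_less_mult_iff)
  note T = vortex_quadratic_root[OF assms this, folded S_def, folded T_def]
  have "2 * \<Gamma>2^2 * S / (\<Gamma>1^2 * (\<Gamma>1^2 - \<Gamma>2^2)^2) = (\<Gamma>2\<^sup>2)\<^sup>2 * T"
    "2 * \<Gamma>1^2 * S / (\<Gamma>2^2 * (\<Gamma>1^2 - \<Gamma>2^2)^2) = (\<Gamma>1\<^sup>2)\<^sup>2 * T"
    using assms by (simp_all add: T_def power2_eq_square mult_ac)
  then have "y1 = \<sigma> * arsinh (\<Gamma>2\<^sup>2 * sqrt T)" "y2 = - \<sigma> * arsinh (\<Gamma>1\<^sup>2 * sqrt T)"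
    by (simp_all only: y real_sqrt_mult real_sqrt_abs abs_power2)
  then have "sinh y1 = \<Gamma>2\<^sup>2 * (\<sigma> * sqrt T)" "sinh y2 = - (\<Gamma>1\<^sup>2 * (\<sigma> * sqrt T))"
    using \<sigma> by auto
  \<comment> \<open>The sign is absorbed into \<open>t = \<sigma> * sqrt T\<close>; the quadratic
    sees only \<open>t\<^sup>2\<close>, so both choices are treated at once.\<close>
  moreover have "\<sigma> * sqrt T \<noteq> 0" "(\<sigma> * sqrt T)\<^sup>2 = T"
    using \<sigma> T(1) by (auto simp: power_mult_distrib)
  ultimately show "fixed_equilibrium \<Gamma>1 \<Gamma>2 (x1, y1) (x2, y2)"
    using vortex_pair_equilibrium[of \<Gamma>1 \<Gamma>2 "\<sigma> * sqrt T" y1 y2 x1] \<Gamma> T(2) x by simp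
next
  assume "\<Gamma>1 * \<Gamma>2 < 0 \<or> \<Gamma>1 = \<Gamma>2"
  then show "\<not> (\<exists>p q. fixed_equilibrium \<Gamma>1 \<Gamma>2 p q)"
    using fixed_equilibrium_imp[OF assms] by (metis less_asym prod.collapse)
qed

end
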